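(* Let $\Omega\subset\mathbb{H}$ be open and h-convex and let $u:\Omega\to[-\infty,\infty)$ be upper semicontinuous. Then $u$ is h-quasiconvex if and only if the following holds: whenever $p\in\Omega$ and $\varphi\in C^1(\Omega)$ are such that $u-\varphi$ attains a maximum at $p$, one has $$\langle\nabla_H\varphi(p),(p^{-1}\cdot\xi)_h\rangle\le 0\quad\text{for every }\xi\in\mathbb{H}_p\cap\Omega\text{ satisfying }u(\xi)<u(p).$$
   Context: The Heisenberg group $\mathbb{H}$ is $\mathbb{R}^3$ (with its usual topology) with the group law $(x_p,y_p,z_p)\cdot(x_q,y_q,z_q)=(x_p+x_q,\,y_p+y_q,\,z_p+z_q+\frac12(x_py_q-x_qy_p))$. Let $\mathbb{H}_0=\{(x,y,0):x,y\in\mathbb{R}\}$ and, for $p\in\mathbb{H}$, $\mathbb{H}_p=\{p\cdot h:h\in\mathbb{H}_0\}$. For $q\in\mathbb{H}_p$, $[p,q]$ denotes the horizontal segment joining $p$ and $q$ (the straight segment from $p$ to $q$). For $\zeta=(x,y,z)\in\mathbb{H}$ write $\zeta_h=(x,y)$. With $X_1=\partial_x-\frac y2\partial_z$ and $X_2=\partial_y+\frac x2\partial_z$, the horizontal gradient is $\nabla_H\varphi=(X_1\varphi,X_2\varphi)$. A set $E\subset\mathbb{H}$ is h-convex if $[p,q]\subset E$ for every $p\in E$ and $q\in\mathbb{H}_p\cap E$. For $\Omega$ h-convex, a function $u$ on $\Omega$ is h-quasiconvex if $u(w)\le\max\{u(p),u(q)\}$ for all $p\in\Omega$, $q\in\mathbb{H}_p\cap\Omega$,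 $w\in[p,q]$. *)

theory Defs
  imports "HOL-Analysis.Analysis"
begin

text \<open>The nested product type carries the Euclidean topology, norm and inner product of
  three-dimensional space.\<close>

type_synonym heis = "real \<times> real \<times> real"

fun heis_mult :: "heis \<Rightarrow> heis \<Rightarrow> heis"  (infixl \<open>\<odot>\<close> 70) where
  "(x, y, z) \<odot> (x', y', z') = (x + x', y + y', z + z' + (x * y' - x' * y) / 2)"

fun heis_inv :: "heis \<Rightarrow> heis" where
  "heis_inv (x, y, z) = (- x, - y, - z)"

lemma group_heis: "group (\<odot>) 0 heis_inv"
proof
  fix a b c :: heis
  show "a \<odot> b \<odot> c = a \<odot> (b \<odot> c)"
    by (cases a; cases b; cases c) (simp add: field_simps)
  show "0 \<odot> a = a"
    by (cases a) (simp add: zero_prod_def)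
  show "heis_inv a \<odot> a = 0"
    by (cases a) (simp add: zero_prod_def)
qed

definition horizontal_plane_0 :: "heis set" where
  "horizontal_plane_0 = {(x, y, 0) | x y. True}"

definition horizontal_plane :: "heis \<Rightarrow> heis set" where
  "horizontal_plane p = {p \<odot> h | h. h \<in> horizontal_plane_0}"

fun horizontal_part :: "heis \<Rightarrow> real \<times> real" where
  "horizontal_part (x, y, z) = (x, y)"

text \<open>The fields are written in terms of the partial derivatives, the values of the Frechet
  derivative on the standard basis. They are only used at points of differentiability.\<close>

definition X1 :: "(heis \<Rightarrow> real) \<Rightarrow> heis \<Rightarrow> real" where
  "X1 \<phi> = (\<lambda>(x, y, z). frechet_derivative \<phi> (at (x, y, z)) (1, 0, 0)
      - y / 2 * frechet_derivative \<phi> (at (x, y, z)) (0, 0, 1))"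

definition X2 :: "(heis \<Rightarrow> real) \<Rightarrow> heis \<Rightarrow> real" where
  "X2 \<phi> = (\<lambda>(x, y, z). frechet_derivative \<phi> (at (x, y, z)) (0, 1, 0)
      + x / 2 * frechet_derivative \<phi> (at (x, y, z)) (0, 0, 1))"

definition horizontal_gradient :: "(heis \<Rightarrow> real) \<Rightarrow> heis \<Rightarrow> real \<times> real" where
  "horizontal_gradient \<phi> p = (X1 \<phi> p, X2 \<phi> p)"

text \<open>Intended for open sets, where it depends only on the restriction of the function to the
  set.\<close>

definition C1_on :: "heis set \<Rightarrow> (heis \<Rightarrow> real) \<Rightarrow> bool" where
  "C1_on S \<phi> \<longleftrightarrow> (\<forall>p\<in>S. \<phi> differentiable (at p)) \<and>
     (\<forall>v. continuous_on S (\<lambda>p. frechet_derivative \<phi> (at p) v))"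

definition upper_semicontinuous_on :: "heis set \<Rightarrow> (heis \<Rightarrow> ereal) \<Rightarrow> bool" where
  "upper_semicontinuous_on S u \<longleftrightarrow>
     (\<forall>p\<in>S. \<forall>c. u p < c \<longrightarrow> (\<forall>\<^sub>F x in at p within S. u x < c))"

definition h_convex :: "heis set \<Rightarrow> bool" where
  "h_convex E \<longleftrightarrow> (\<forall>p\<in>E. \<forall>q\<in>horizontal_plane p \<inter> E. closed_segment p q \<subseteq> E)"

definition h_quasiconvex_on :: "heis set \<Rightarrow> (heis \<Rightarrow> ereal) \<Rightarrow> bool" where
  "h_quasiconvex_on \<Omega> u \<longleftrightarrow>
     (\<forall>p\<in>\<Omega>. \<forall>q\<in>horizontal_plane p \<inter> \<Omega>. \<forall>w\<in>closed_segment p q. u w \<le> max (u p) (u q))"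

end

theory Submission
  imports Defs
begin

text \<open>If \<open>u\<close> is h-quasiconvex and \<open>u \<xi> < u p\<close>, then \<open>u\<close> is at least \<open>u p\<close> at the points
  of the horizontal line through \<open>p\<close> and \<open>\<xi>\<close> just beyond \<open>p\<close>, and so \<open>\<phi>\<close> is at least \<open>\<phi> p\<close> there.
  Conversely, if quasiconvexity fails on a horizontal segment, one maximises
  \<open>u - \<alpha> s - N \<kappa> G\<close>. Here \<open>s\<close> is the affine parameter along the segment, \<open>\<kappa>\<close> vanishes
  exactly on the segment and is constant along the left-invariant field of its direction where \<open>0 < s < 1\<close>,
  and \<open>G\<close> is a continuously differentiable majorant of \<open>u\<close>. For small \<open>\<alpha>\<close> and large \<open>N\<close> the maximum
  point lies near the interior of the segment, where the derivative of the test function along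
  the field is \<open>\<alpha>\<close> plus an error of smaller modulus; a horizontal translate of that point lies close to the
  end point of the segment, which contradicts the gradient condition.\<close>

subsection \<open>Continuously differentiable functions\<close>

text \<open>Squaring removes the corner of the positive part: at the origin the difference quotient
  is bounded by \<open>\<bar>h\<bar>\<close>. Both the bump functions and the end terms of the
  penalty are built from this function.\<close>

lemma has_real_derivative_pos_part_square:
  "((\<lambda>x. (max 0 x)\<^sup>2) has_real_derivative 2 * max 0 x) (at x)"
proof (cases x "0::real" rule: linorder_cases)
  case less
  have "((\<lambda>x. 0) has_real_derivative 2 * max 0 x) (at x)"
    using less by simp
  then show ?thesis
    by (rule has_field_derivative_transform_within_open[where S="{..<0}"]) (use less in auto)
next
  case equal
  have "((\<lambda>h::real. (max 0 h)\<^sup>2 / h) \<longlongrightarrow> 0) (at 0)"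
  proof (rule Lim_null_comparison)
    show "\<forall>\<^sub>F h in at (0::real). norm ((max 0 h)\<^sup>2 / h) \<le> \<bar>h\<bar>"
      by (rule always_eventually) (auto simp: max_def power2_eq_square abs_if)
    show "((\<lambda>h::real. \<bar>h\<bar>) \<longlongrightarrow> 0) (at 0)"
      by (rule tendsto_eq_intros refl | simp)+
  qed
  then show ?thesis
    using equal by (simp add: DERIV_def)
next
  case greater
  have "((\<lambda>x. x\<^sup>2) has_real_derivative 2 * max 0 x) (at x)"
    using greater by (auto intro!: derivative_eq_intros)
  then show ?thesis
    by (rule has_field_derivative_transform_within_open[where S="{0<..}"]) (use greater in auto)
qed

text \<open>\<open>C1_on\<close> speaks of \<open>frechet_derivative\<close>; uniqueness of the
  derivative allows an explicit formula to be used instead.\<close>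

lemma C1_onI:
  assumes "\<And>x. x \<in> S \<Longrightarrow> (f has_derivative f' x) (at x)"
    and "\<And>v. continuous_on S (\<lambda>x. f' x v)"
  shows "C1_on S f"
proof -
  have "frechet_derivative f (at x) = f' x" if "x \<in> S" for x
    using frechet_derivative_at assms(1)[OF that] by force
  moreover have "f differentiable (at x)" if "x \<in> S" for x
    using assms(1)[OF that] by (rule differentiableI)
  ultimately show ?thesis
    unfolding C1_on_def using assms(2) by (simp cong: continuous_on_cong)
qed

lemma C1_on_has_derivative:
  assumes "C1_on S f" "x \<in> S"
  shows "(f has_derivative frechet_derivative f (at x)) (at x)"
  using assms by (simp add: C1_on_def frechet_derivative_works)

lemma C1_on_continuous_derivative:
  assumes "C1_on S f"
  shows "continuous_on S (\<lambda>x. frechet_derivative f (at x) v)"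
  using assms unfolding C1_on_def by blast

lemma C1_on_continuous_on: "C1_on S f \<Longrightarrow> continuous_on S f"
  by (meson C1_on_def continuous_at_imp_continuous_on differentiable_imp_continuous_within)

lemma C1_on_bounded_linear:
  assumes "bounded_linear f" shows "C1_on S f"
  by (rule C1_onI[where f'="\<lambda>x. f"])
    (auto intro: bounded_linear_imp_has_derivative assms)

lemma C1_on_const: "C1_on S (\<lambda>x. c)"
  by (rule C1_onI[where f'="\<lambda>x v. 0"]) auto

lemma C1_on_add:
  assumes "C1_on S f" "C1_on S g" shows "C1_on S (\<lambda>x. f x + g x)"
  by (rule C1_onI[where f'="\<lambda>x v. frechet_derivative f (at x) v + frechet_derivative g (at x) v"])
    (auto intro!: has_derivative_add continuous_on_add
      C1_on_has_derivative C1_on_continuous_derivative assms)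

lemma C1_on_mult:
  assumes "C1_on S f" "C1_on S g" shows "C1_on S (\<lambda>x. f x * g x)"
proof (rule C1_onI)
  show "((\<lambda>x. f x * g x) has_derivative (\<lambda>v. f x * frechet_derivative g (at x) v
      + frechet_derivative f (at x) v * g x)) (at x)" if "x \<in> S" for x
    using that assms by (intro has_derivative_mult C1_on_has_derivative)
  show "continuous_on S (\<lambda>x. f x * frechet_derivative g (at x) v
      + frechet_derivative f (at x) v * g x)" for v
    using assms
    by (intro continuous_on_add continuous_on_mult C1_on_continuous_derivative C1_on_continuous_on)
qed

lemma C1_on_compose:
  assumes "C1_on S f"
    and "\<And>x. x \<in> S \<Longrightarrow> (F has_real_derivative F' (f x)) (at (f x))"
    and "continuous_on (f ` S) F'"
  shows "C1_on S (\<lambda>x. F (f x))"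
proof (rule C1_onI[where f'="\<lambda>x v. F' (f x) * frechet_derivative f (at x) v"])
  fix x assume "x \<in> S"
  then show "((\<lambda>x. F (f x)) has_derivative (\<lambda>v. F' (f x) * frechet_derivative f (at x) v)) (at x)"
    using has_derivative_compose[OF C1_on_has_derivative[OF assms(1)], of x F "\<lambda>v. F' (f x) * v"]
      assms(2)[of x] by (simp add: has_field_derivative_def)
next
  fix v
  show "continuous_on S (\<lambda>x. F' (f x) * frechet_derivative f (at x) v)"
    by (intro continuous_on_mult C1_on_continuous_derivative assms(1)
        continuous_on_compose2[OF assms(3)] C1_on_continuous_on) auto
qed

lemma C1_on_pos_part_square: "C1_on S f \<Longrightarrow> C1_on S (\<lambda>x. (max 0 (f x))\<^sup>2)"
  by (rule C1_on_compose[where F="\<lambda>x. (max 0 x)\<^sup>2" and F'="\<lambda>x. 2 * max 0 x",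
        OF _ has_real_derivative_pos_part_square])
    (auto intro!: continuous_intros)

lemma C1_on_inverse:
  assumes "C1_on S f" "\<And>x. x \<in> S \<Longrightarrow> f x \<noteq> 0"
  shows "C1_on S (\<lambda>x. inverse (f x))"
  by (rule C1_on_compose[where F=inverse, OF assms(1) DERIV_inverse])
    (use assms(2) in \<open>auto intro!: continuous_intros\<close>)

lemma C1_on_diff: "C1_on S f \<Longrightarrow> C1_on S g \<Longrightarrow> C1_on S (\<lambda>x. f x - g x)"
  using C1_on_add[of S f "\<lambda>x. - 1 * g x"] C1_on_mult[OF C1_on_const, of S g "- 1"] by simp

lemma C1_on_divide_const: "C1_on S f \<Longrightarrow> C1_on S (\<lambda>x. f x / c)"
  using C1_on_mult[OF _ C1_on_const, of S f "inverse c"] by (simp add: divide_inverse)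

lemma C1_on_power2: "C1_on S f \<Longrightarrow> C1_on S (\<lambda>x. (f x)\<^sup>2)"
  unfolding power2_eq_square by (rule C1_on_mult)

lemma C1_on_coordinates:
  "C1_on S fst" "C1_on S (\<lambda>x. fst (snd x))" "C1_on S (\<lambda>x. snd (snd x))"
  by (intro C1_on_bounded_linear bounded_linear_fst bounded_linear_compose[OF bounded_linear_fst]
      bounded_linear_compose[OF bounded_linear_snd] bounded_linear_snd)+

lemmas C1_on_intros = C1_on_const C1_on_add C1_on_diff C1_on_mult C1_on_divide_const C1_on_power2
  C1_on_pos_part_square C1_on_coordinates

subsection \<open>Upper semicontinuous functions\<close>

text \<open>Neighbourhoods are taken in the whole space, which changes nothing on open sets. Values
  are real: the given extended-valued function enters after truncation from below.\<close>

definition usc_on :: "'a::topological_space set \<Rightarrow> ('a \<Rightarrow> real) \<Rightarrow> bool" where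
  "usc_on S f \<longleftrightarrow> (\<forall>x\<in>S. \<forall>c>f x. \<forall>\<^sub>F y in nhds x. f y < c)"

lemma usc_onD: "usc_on S f \<Longrightarrow> x \<in> S \<Longrightarrow> f x < c \<Longrightarrow> \<forall>\<^sub>F y in nhds x. f y < c"
  by (simp add: usc_on_def)

lemma usc_on_open_sublevel:
  assumes "usc_on S f" "open S"
  shows "open {x \<in> S. f x < c}"
proof (subst open_subopen, clarify)
  fix x assume "x \<in> S" "f x < c"
  then have "\<forall>\<^sub>F y in nhds x. y \<in> S \<and> f y < c"
    using usc_onD[OF assms(1)] eventually_nhds_in_open[OF assms(2)] eventually_conj by blast
  then show "\<exists>T. open T \<and> x \<in> T \<and> T \<subseteq> {x \<in> S. f x < c}"
    unfolding eventually_nhds by blast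
qed

lemma usc_on_add_continuous:
  fixes f g :: "'a::t2_space \<Rightarrow> real"
  assumes f: "usc_on S f" and g: "continuous_on S g" and S: "open S"
  shows "usc_on S (\<lambda>x. f x + g x)"
  unfolding usc_on_def
proof (intro ballI allI impI)
  fix x c assume x: "x \<in> S" and c: "f x + g x < c"
  \<comment> \<open>Half of the slack \<open>c - f x - g x\<close> goes to each summand.\<close>
  have "f x < (c + f x - g x) / 2" "g x < (c - f x + g x) / 2"
    using c by (simp_all add: field_simps)
  moreover have "(g \<longlongrightarrow> g x) (nhds x)"
    using g S x by (simp add: continuous_on_eq_continuous_at isCont_def flip: tendsto_at_iff_tendsto_nhds)
  ultimately have "\<forall>\<^sub>F y in nhds x. f y < (c + f x - g x) / 2"
    "\<forall>\<^sub>F y in nhds x. g y < (c - f x + g x) / 2"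
    using usc_onD[OF f x] order_tendstoD(2) by blast+
  then show "\<forall>\<^sub>F y in nhds x. f y + g y < c"
    by eventually_elim (simp add: field_simps)
qed

text \<open>Without a maximum, compactness would cover \<open>K\<close> by finitely many of the open
  sets \<open>f < f y\<close> with \<open>y\<close> in \<open>K\<close>; among these
  \<open>y\<close>, one with the largest value lies in none of them.\<close>

lemma usc_on_attains_max:
  assumes f: "usc_on S f" and S: "open S" and K: "compact K" "K \<noteq> {}" "K \<subseteq> S"
  shows "\<exists>x\<in>K. \<forall>y\<in>K. f y \<le> f x"
proof (rule ccontr)
  assume "\<not> (\<exists>x\<in>K. \<forall>y\<in>K. f y \<le> f x)"
  then have "\<forall>x\<in>K. \<exists>y\<in>K. f x < f y"
    by (simp add: not_le)
  then have "K \<subseteq> (\<Union>y\<in>K. {x \<in> S. f x < f y})"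
    using K(3) by blast
  then obtain D where D: "D \<subseteq> K" "finite D" "K \<subseteq> (\<Union>y\<in>D. {x \<in> S. f x < f y})"
    using compactE_image[OF K(1), of K "\<lambda>y. {x \<in> S. f x < f y}"] usc_on_open_sublevel[OF f S]
    by metis
  then have "D \<noteq> {}"
    using K(2) by auto
  then have "Max (f ` D) \<in> f ` D"
    using D(2) by simp
  then obtain x where x: "x \<in> D" "f x = Max (f ` D)"
    by auto
  then obtain y where y: "y \<in> D" "f x < f y"
    using D by blast
  then have "f y \<le> Max (f ` D)"
    using D(2) by simp
  then show False
    using x y by simp
qed

subsection \<open>Continuously differentiable majorants\<close>

text \<open>The Weierstrass test gives uniform convergence of the gradient series, hence a
  continuous sum and termwise differentiation. Gradients are kept as vectors, so that Cauchy-Schwarz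
  turns this convergence into the estimate on derivatives.\<close>

lemma C1_on_suminf:
  fixes f :: "nat \<Rightarrow> heis \<Rightarrow> real"
  assumes deriv: "\<And>n x. (f n has_derivative (\<lambda>v. g n x \<bullet> v)) (at x)"
    and cont: "\<And>n. continuous_on UNIV (g n)"
    and bound: "\<And>n x. norm (g n x) \<le> M n" and M: "summable M"
    and f: "\<And>x. summable (\<lambda>n. f n x)"
  shows "C1_on S (\<lambda>x. \<Sum>n. f n x)"
proof -
  define G where "G x = (\<Sum>n. g n x)" for x
  have unif: "uniform_limit UNIV (\<lambda>n x. \<Sum>i<n. g i x) G sequentially"
    unfolding G_def by (rule Weierstrass_m_test[OF bound M])
  have contG: "continuous_on UNIV G"
    by (rule uniform_limit_theorem[OF _ unif]) (auto intro!: always_eventually continuous_on_sum cont)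
  have "\<exists>F. \<forall>x\<in>UNIV. (\<lambda>n. f n x) sums F x \<and> (F has_derivative (\<lambda>v. G x \<bullet> v)) (at x)"
  proof (rule has_derivative_series[where x=0 and l="\<Sum>n. f n 0" and f'="\<lambda>n x v. g n x \<bullet> v"])
    fix e :: real assume "e > 0"
    then have "\<forall>\<^sub>F n in sequentially. \<forall>x\<in>UNIV. dist (\<Sum>i<n. g i x) (G x) < e"
      using unif by (rule uniform_limitD[rotated])
    then show "\<forall>\<^sub>F n in sequentially. \<forall>x\<in>UNIV. \<forall>v.
      norm ((\<Sum>i<n. g i x \<bullet> v) - G x \<bullet> v) \<le> e * norm v"
    proof eventually_elim
      case (elim n)
      show ?case
      proof (intro ballI allI)
        fix x v
        have "norm ((\<Sum>i<n. g i x \<bullet> v) - G x \<bullet> v) = \<bar>((\<Sum>i<n. g i x) - G x) \<bullet> v\<bar>"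
          by (simp add: inner_sum_left inner_diff_left)
        also have "\<dots> \<le> norm ((\<Sum>i<n. g i x) - G x) * norm v"
          by (rule Cauchy_Schwarz_ineq2)
        also have "\<dots> \<le> e * norm v"
          using bspec[OF elim UNIV_I, of x] by (intro mult_right_mono) (auto simp: dist_norm)
        finally show "norm ((\<Sum>i<n. g i x \<bullet> v) - G x \<bullet> v) \<le> e * norm v" .
      qed
    qed
  qed (rule convex_UNIV UNIV_I deriv summable_sums f)+
  then obtain F where F: "\<And>x. (\<lambda>n. f n x) sums F x" "\<And>x. (F has_derivative (\<lambda>v. G x \<bullet> v)) (at x)"
    by auto
  then have "(\<lambda>x. \<Sum>n. f n x) = F"
    by (simp add: sums_iff fun_eq_iff)
  moreover have "C1_on S F"
    by (rule C1_onI[OF F(2)]) (intro continuous_on_inner continuous_on_const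
        continuous_on_subset[OF contG] subset_UNIV)
  ultimately show ?thesis
    by simp
qed

section \<open>Bump functions on balls\<close>

definition bump :: "'a::euclidean_space \<Rightarrow> real \<Rightarrow> 'a \<Rightarrow> real" where
  "bump a r x = (max 0 (r\<^sup>2 - (x - a) \<bullet> (x - a)))\<^sup>2"

definition bump_grad :: "'a::euclidean_space \<Rightarrow> real \<Rightarrow> 'a \<Rightarrow> 'a" where
  "bump_grad a r x = (- 4 * max 0 (r\<^sup>2 - (x - a) \<bullet> (x - a))) *\<^sub>R (x - a)"

lemma bump_nonneg: "0 \<le> bump a r x"
  by (simp add: bump_def)

lemma bump_le_1:
  assumes "0 < r" "r \<le> 1" shows "bump a r x \<le> 1"
proof -
  have "r\<^sup>2 \<le> 1"
    using assms by (simp add: power_le_one)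
  then have "max 0 (r\<^sup>2 - (x - a) \<bullet> (x - a)) \<le> 1"
    using inner_ge_zero[of "x - a"] by linarith
  then show ?thesis
    unfolding bump_def by (simp add: power_le_one)
qed

lemma bump_pos_iff:
  assumes "0 < r" shows "0 < bump a r x \<longleftrightarrow> x \<in> ball a r"
proof -
  have "(x - a) \<bullet> (x - a) < r\<^sup>2 \<longleftrightarrow> norm (x - a) < r"
    unfolding dot_square_norm using assms power2_less_imp_less[of "norm (x - a)" r]
      power_strict_mono[of "norm (x - a)" r 2] by auto
  then show ?thesis
    by (auto simp: bump_def dist_norm norm_minus_commute max_def zero_less_power2)
qed

lemma has_derivative_bump: "(bump a r has_derivative (\<lambda>v. bump_grad a r x \<bullet> v)) (at x)"
proof -
  have "((\<lambda>x. r\<^sup>2 - (x - a) \<bullet> (x - a)) has_derivative (\<lambda>v. - 2 * ((x - a) \<bullet> v))) (at x)"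
    by (auto intro!: derivative_eq_intros simp: inner_commute)
  from has_derivative_compose[OF this has_real_derivative_pos_part_square[unfolded has_field_derivative_def]]
  show ?thesis
    by (simp add: bump_def[abs_def] bump_grad_def mult.assoc)
qed

lemma continuous_on_bump_grad: "continuous_on S (bump_grad a r)"
  unfolding bump_grad_def[abs_def] by (intro continuous_intros)

text \<open>The gradient vanishes off the ball, and inside it \<open>norm (x - a)\<close> and the
  positive part are both at most 1. A bound independent of the ball leaves convergence of the
  gradient series to the coefficients.\<close>

lemma norm_bump_grad_le:
  assumes "0 < r" "r \<le> 1" shows "norm (bump_grad a r x) \<le> 4"
proof (cases "norm (x - a) < r")
  case True
  have "r\<^sup>2 \<le> 1"
    using assms by (simp add: power_le_one)
  then have "max 0 (r\<^sup>2 - (x - a) \<bullet> (x - a)) \<le> 1"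
    using inner_ge_zero[of "x - a"] by linarith
  then have "max 0 (r\<^sup>2 - (x - a) \<bullet> (x - a)) * norm (x - a) \<le> 1 * 1"
    by (rule mult_mono) (use True assms in auto)
  then show ?thesis
    by (simp add: bump_grad_def abs_mult)
next
  case False
  then have "r\<^sup>2 \<le> (x - a) \<bullet> (x - a)"
    using assms by (simp add: dot_square_norm power_mono)
  then show ?thesis
    by (simp add: bump_grad_def)
qed

text \<open>The reciprocal of the majorant is a series of bump functions, each damped by an upper
  bound of the function on its ball, so no locally finite partition of unity is needed.\<close>

lemma C1_majorant:
  fixes f :: "heis \<Rightarrow> real"
  assumes f: "usc_on S f" and S: "open S"
  shows "\<exists>G. C1_on S G \<and> (\<forall>x\<in>S. f x \<le> G x \<and> 1 \<le> G x)"
proof (cases "S = {}")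
  case True
  then show ?thesis by (auto simp: C1_on_def)
next
  case False
  \<comment> \<open>Upper semicontinuity bounds \<open>f\<close> by \<open>f x + 1\<close> near
    \<open>x\<close>; radii at most 1 keep the bump bounds uniform.\<close>
  have "\<exists>r. 0 < r \<and> r \<le> 1 \<and> ball x r \<subseteq> {y \<in> S. f y < f x + 1}" if "x \<in> S" for x
  proof -
    have "open {y \<in> S. f y < f x + 1}" "x \<in> {y \<in> S. f y < f x + 1}"
      using usc_on_open_sublevel[OF f S] that by auto
    then obtain e where "0 < e" "ball x e \<subseteq> {y \<in> S. f y < f x + 1}"
      unfolding open_contains_ball by blast
    then have "0 < min e 1 \<and> min e 1 \<le> 1 \<and> ball x (min e 1) \<subseteq> {y \<in> S. f y < f x + 1}"
      using subset_ball[of "min e 1" e x] by simp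
    then show ?thesis ..
  qed
  then obtain r where r: "\<And>x. x \<in> S \<Longrightarrow> 0 < r x \<and> r x \<le> 1 \<and> ball x (r x) \<subseteq> {y \<in> S. f y < f x + 1}"
    using bchoice[of S "\<lambda>x r. 0 < r \<and> r \<le> 1 \<and> ball x r \<subseteq> {y \<in> S. f y < f x + 1}"] by blast
  \<comment> \<open>The Lindelof property reduces the cover to a countable one, so that a series
    suffices.\<close>
  obtain B where B: "B \<subseteq> (\<lambda>x. ball x (r x)) ` S" "countable B" "\<Union>B = (\<Union>x\<in>S. ball x (r x))"
    by (rule Lindelof[of "(\<lambda>x. ball x (r x)) ` S"]) (use open_ball in blast)+
  then obtain C where C: "C \<subseteq> S" "countable C" "B = (\<lambda>x. ball x (r x)) ` C"
    using countable_subset_image[of B "\<lambda>x. ball x (r x)" S] by auto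
  have cover: "S \<subseteq> (\<Union>x\<in>C. ball x (r x))"
  proof
    fix x assume "x \<in> S"
    then have "x \<in> ball x (r x)"
      using r by simp
    then have "x \<in> (\<Union>x\<in>S. ball x (r x))"
      using \<open>x \<in> S\<close> by blast
    then show "x \<in> (\<Union>x\<in>C. ball x (r x))"
      using B(3) C(3) by simp
  qed
  then have "C \<noteq> {}"
    using False by auto
  \<comment> \<open>The enumeration may repeat centres; the weights decay with the index, so
    repetition does no harm.\<close>
  define a where "a = from_nat_into C"
  have a: "a n \<in> S" for n
    using from_nat_into[OF \<open>C \<noteq> {}\<close>] C(1) by (auto simp: a_def)
  \<comment> \<open>\<open>M n\<close> is at least 1 and bounds \<open>f\<close> on the ball of
    index \<open>n\<close>; dividing by it keeps the sum small where \<open>f\<close> is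
    large.\<close>
  define M where "M n = max 1 (f (a n) + 1)" for n
  define c where "c n = (1 / 2) ^ Suc n / M n" for n
  have M: "1 \<le> M n" "0 < M n" for n
    by (auto simp: M_def)
  have c: "0 < c n" "c n \<le> (1 / 2) ^ Suc n" for n
    using M[of n] by (auto simp: c_def field_simps)
  define b where "b n x = c n * bump (a n) (r (a n)) x" for n x
  have sum_half: "summable (\<lambda>n. (1 / 2 :: real) ^ Suc n)"
    using power_half_series by (rule sums_summable)
  have b_nonneg: "0 \<le> b n x" for n x
    using c(1)[of n] by (simp add: b_def bump_nonneg)
  have b_le_c: "b n x \<le> c n" for n x
    unfolding b_def by (rule mult_left_le) (use r[OF a[of n]] c(1)[of n] bump_le_1 in \<open>auto intro: less_imp_le\<close>)
  have sum_b: "summable (\<lambda>n. b n x)" for x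
  proof (rule summable_comparison_test'[OF sum_half, of 0])
    show "norm (b n x) \<le> (1 / 2) ^ Suc n" for n
      using b_nonneg[of n x] b_le_c[of n x] c(2)[of n] by simp
  qed
  define \<theta> where "\<theta> x = (\<Sum>n. b n x)" for x
  have C1: "C1_on S \<theta>"
    unfolding \<theta>_def[abs_def]
  proof (rule C1_on_suminf[where g="\<lambda>n x. c n *\<^sub>R bump_grad (a n) (r (a n)) x"
        and M="\<lambda>n. (1 / 2) ^ Suc n * 4"])
    show "(b n has_derivative (\<lambda>v. (c n *\<^sub>R bump_grad (a n) (r (a n)) x) \<bullet> v)) (at x)" for n x
      unfolding b_def[abs_def]
      using has_derivative_mult_right[OF has_derivative_bump, of "c n"] by simp
    show "norm (c n *\<^sub>R bump_grad (a n) (r (a n)) x) \<le> (1 / 2) ^ Suc n * 4" for n x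
      unfolding norm_scaleR using c[of n] r[OF a[of n]] norm_bump_grad_le[of "r (a n)" "a n" x]
      by (intro mult_mono) auto
    show "summable (\<lambda>n. (1 / 2 :: real) ^ Suc n * 4)"
      using sum_half by (rule summable_mult2)
  qed (use sum_b in \<open>auto intro!: continuous_intros continuous_on_bump_grad\<close>)
  have pos: "0 < \<theta> x" if x: "x \<in> S" for x
  proof -
    obtain y where y: "y \<in> C" "x \<in> ball y (r y)"
      using cover x by blast
    then obtain n where n: "a n = y"
      unfolding a_def using from_nat_into_surj[OF C(2)] by blast
    have "0 < b n x"
      using bump_pos_iff[of "r y" y x] y r[OF a[of n]] c(1)[of n] n by (simp add: b_def)
    then show ?thesis
      unfolding \<theta>_def using sum_b b_nonneg suminf_pos2 by blast
  qed
  \<comment> \<open>Terms active at \<open>x\<close> have \<open>M n\<close> at least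
    \<open>max 1 (f x)\<close>, the others vanish, and the weights \<open>(1 / 2) ^ Suc n\<close>
    sum to 1.\<close>
  have le: "\<theta> x \<le> 1 / max 1 (f x)" if x: "x \<in> S" for x
  proof -
    have "b n x \<le> (1 / 2) ^ Suc n * (1 / max 1 (f x))" for n
    proof (cases "x \<in> ball (a n) (r (a n))")
      case True
      then have "max 1 (f x) \<le> M n"
        using r[OF a[of n]] by (force simp: M_def)
      then have "c n \<le> (1 / 2) ^ Suc n * (1 / max 1 (f x))"
        unfolding c_def by (auto simp: field_simps intro!: divide_left_mono mult_pos_pos M)
      then show ?thesis
        using b_le_c order_trans by blast
    next
      case False
      then have "b n x = 0"
        using bump_pos_iff[of "r (a n)" "a n" x] r[OF a[of n]] bump_nonneg[of "a n" "r (a n)" x]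
        by (simp add: b_def)
      then show ?thesis by simp
    qed
    then have "\<theta> x \<le> (\<Sum>n. (1 / 2) ^ Suc n * (1 / max 1 (f x)))"
      unfolding \<theta>_def by (intro suminf_le sum_b summable_mult2 sum_half)
    also have "\<dots> = 1 / max 1 (f x)"
      using sums_mult2[OF power_half_series, of "1 / max 1 (f x)"] by (simp add: sums_iff)
    finally show ?thesis .
  qed
  show ?thesis
  proof (intro exI[of _ "\<lambda>x. inverse (\<theta> x)"] conjI ballI)
    show "C1_on S (\<lambda>x. inverse (\<theta> x))"
      using C1 by (rule C1_on_inverse) (use pos in force)
    fix x assume x: "x \<in> S"
    have "max 1 (f x) \<le> inverse (\<theta> x)"
      using le_imp_inverse_le[OF le[OF x] pos[OF x]] by simp
    then show "f x \<le> inverse (\<theta> x)" "1 \<le> inverse (\<theta> x)"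
      by auto
  qed
qed

subsection \<open>Horizontal derivatives\<close>

text \<open>The value at \<open>p\<close> of the left-invariant vector field
  \<open>a X1 + b X2\<close>, written as a Euclidean vector.\<close>

definition horizontal_field :: "real \<Rightarrow> real \<Rightarrow> heis \<Rightarrow> heis" where
  "horizontal_field a b p = (a, b, (fst p * b - fst (snd p) * a) / 2)"

lemma horizontal_field_scale: "horizontal_field (c * a) (c * b) p = c *\<^sub>R horizontal_field a b p"
  by (simp add: horizontal_field_def algebra_simps)

text \<open>The vertical component changes by a multiple of \<open>a * b - b * a\<close>. Integral
  curves are therefore straight lines, traversed with constant velocity.\<close>

lemma horizontal_field_along:
  "horizontal_field a b (p + c *\<^sub>R horizontal_field a b p) = horizontal_field a b p"
  by (cases p) (simp add: horizontal_field_def algebra_simps)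

lemma horizontal_plane_iff: "q \<in> horizontal_plane p \<longleftrightarrow> (\<exists>a b. q = p + horizontal_field a b p)"
proof -
  have "p \<odot> (a, b, 0) = p + horizontal_field a b p" for a b
    by (cases p) (simp add: horizontal_field_def algebra_simps)
  then show ?thesis
    by (auto simp: horizontal_plane_def horizontal_plane_0_def)
qed

lemma horizontal_part_displacement:
  "horizontal_part (heis_inv p \<odot> (p + horizontal_field a b p)) = (a, b)"
  by (cases p) (simp add: horizontal_field_def)

lemma frechet_derivative_horizontal_field:
  assumes "\<phi> differentiable (at p)"
  shows "frechet_derivative \<phi> (at p) (horizontal_field a b p)
    = a * frechet_derivative \<phi> (at p) (1, 0, 0) + b * frechet_derivative \<phi> (at p) (0, 1, 0)
      + (fst p * b - fst (snd p) * a) / 2 * frechet_derivative \<phi> (at p) (0, 0, 1)"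
proof -
  have "horizontal_field a b p
    = a *\<^sub>R (1, 0, 0) + b *\<^sub>R (0, 1, 0) + ((fst p * b - fst (snd p) * a) / 2) *\<^sub>R (0, 0, 1)"
    by (simp add: horizontal_field_def)
  then show ?thesis
    by (simp only: linear_add[OF linear_frechet_derivative[OF assms]]
        linear_scale[OF linear_frechet_derivative[OF assms]] real_scaleR_def)
qed

text \<open>Together with \<open>horizontal_part_displacement\<close> this turns the pairing in the
  gradient condition into a directional derivative.\<close>

lemma horizontal_gradient_inner:
  assumes "\<phi> differentiable (at p)"
  shows "horizontal_gradient \<phi> p \<bullet> (a, b) = frechet_derivative \<phi> (at p) (horizontal_field a b p)"
  unfolding frechet_derivative_horizontal_field[OF assms]
  by (cases p) (simp add: horizontal_gradient_def X1_def X2_def algebra_simps diff_divide_distrib)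

section \<open>Directional derivatives along lines\<close>

lemma DERIV_along_line:
  fixes f :: "'a::real_normed_vector \<Rightarrow> real"
  assumes "f differentiable (at p)"
  shows "((\<lambda>t. f (p + t *\<^sub>R v)) has_real_derivative frechet_derivative f (at p) v) (at 0)"
proof -
  have "((\<lambda>t. p + t *\<^sub>R v) has_derivative (\<lambda>t. t *\<^sub>R v)) (at 0)"
    by (auto intro!: derivative_eq_intros)
  moreover have "(f has_derivative frechet_derivative f (at p)) (at (p + 0 *\<^sub>R v))"
    using assms by (simp add: frechet_derivative_works)
  ultimately have "((\<lambda>t. f (p + t *\<^sub>R v)) has_derivative
      (\<lambda>t. frechet_derivative f (at p) (t *\<^sub>R v))) (at 0)"
    by (rule has_derivative_compose)
  then show ?thesis
    by (simp add: has_field_derivative_def linear_scale[OF linear_frechet_derivative[OF assms]]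
        mult.commute[of _ "frechet_derivative f (at p) v"])
qed

text \<open>Serves to read derivatives off the behaviour along a line instead of differentiating
  explicit formulas.\<close>

lemma frechet_derivative_affine_line:
  fixes f :: "'a::real_normed_vector \<Rightarrow> real"
  assumes "f differentiable (at p)" "0 < e"
    and "\<And>t. \<bar>t\<bar> < e \<Longrightarrow> f (p + t *\<^sub>R v) = f p + t * c"
  shows "frechet_derivative f (at p) v = c"
proof -
  have "((\<lambda>t. f p + t * c) has_real_derivative c) (at 0)"
    by (auto intro!: derivative_eq_intros)
  then have "((\<lambda>t. f (p + t *\<^sub>R v)) has_real_derivative c) (at 0)"
    by (rule has_field_derivative_transform_within[OF _ assms(2) UNIV_I])
      (simp add: assms(3) dist_real_def)
  then show ?thesis
    using DERIV_along_line[OF assms(1)] DERIV_unique by blast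
qed

subsection \<open>Penalising the distance to a horizontal segment\<close>

text \<open>The functions below are coordinates in which right translation by the one-parameter
  subgroup through \<open>(a, b, 0)\<close> is translation of \<open>along\<close>; the term \<open>along * across / 2\<close>
  straightens the left-invariant field.\<close>

locale horizontal_line =
  fixes x\<^sub>0 y\<^sub>0 z\<^sub>0 a b :: real
  assumes nonzero: "0 < a\<^sup>2 + b\<^sup>2"
begin

definition along :: "heis \<Rightarrow> real" where
  "along p = (a * (fst p - x\<^sub>0) + b * (fst (snd p) - y\<^sub>0)) / (a\<^sup>2 + b\<^sup>2)"

definition across :: "heis \<Rightarrow> real" where
  "across p = a * (fst (snd p) - y\<^sub>0) - b * (fst p - x\<^sub>0)"

text \<open>The summands other than the product form the third coordinate of \<open>p\<close> after
  the left translation that takes \<open>(x\<^sub>0, y\<^sub>0, z\<^sub>0)\<close> to the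
  origin.\<close>

definition vertical :: "heis \<Rightarrow> real" where
  "vertical p = snd (snd p) - z\<^sub>0 + (y\<^sub>0 * fst p - x\<^sub>0 * fst (snd p)) / 2 + along p * across p / 2"

text \<open>Recovers a point from its coordinates \<open>along\<close>, \<open>across\<close> and
  \<open>vertical\<close>: the planar displacement is expanded in the orthogonal vectors
  \<open>(a, b)\<close> and \<open>(- b, a)\<close>.\<close>

definition point :: "real \<times> real \<times> real \<Rightarrow> heis" where
  "point = (\<lambda>(s, t, z). let x = x\<^sub>0 + s * a - t * b / (a\<^sup>2 + b\<^sup>2); y = y\<^sub>0 + s * b + t * a / (a\<^sup>2 + b\<^sup>2)
    in (x, y, z\<^sub>0 + z - s * t / 2 - (y\<^sub>0 * x - x\<^sub>0 * y) / 2))"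

text \<open>The positive parts act only beyond the two ends, so between them the value depends only
  on the two coordinates that are constant along the field.\<close>

definition penalty :: "heis \<Rightarrow> real" where
  "penalty p = (across p)\<^sup>2 + (vertical p)\<^sup>2 + (max 0 (0 - along p))\<^sup>2 + (max 0 (along p - 1))\<^sup>2"

abbreviation field :: "heis \<Rightarrow> heis" where
  "field \<equiv> horizontal_field a b"

abbreviation segment_point :: "real \<Rightarrow> heis" where
  "segment_point s \<equiv> (x\<^sub>0, y\<^sub>0, z\<^sub>0) + s *\<^sub>R field (x\<^sub>0, y\<^sub>0, z\<^sub>0)"

lemma along_field: "along (p + c *\<^sub>R field p) = along p + c"
proof -
  have "a * (fst p + c * a - x\<^sub>0) + b * (fst (snd p) + c * b - y\<^sub>0)
    = (a * (fst p - x\<^sub>0) + b * (fst (snd p) - y\<^sub>0)) + c * (a\<^sup>2 + b\<^sup>2)"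
    by (simp add: algebra_simps power2_eq_square)
  then show ?thesis
    using nonzero by (auto simp: along_def horizontal_field_def add_divide_distrib)
qed

lemma across_field: "across (p + c *\<^sub>R field p) = across p"
  by (simp add: across_def horizontal_field_def algebra_simps)

text \<open>Along the field the translated third coordinate changes by
  \<open>- c * across p / 2\<close>, and the product term by the opposite amount.\<close>

lemma vertical_field: "vertical (p + c *\<^sub>R field p) = vertical p"
  unfolding vertical_def along_field across_field
  by (simp add: across_def horizontal_field_def field_simps)

lemma along_segment_point: "along (segment_point s) = s"
  unfolding along_field by (simp add: along_def)

lemma point_coordinates: "point (along p, across p, vertical p) = p"
proof -
  obtain x y z where p: "p = (x, y, z)"
    by (cases p)
  define r where "r = a\<^sup>2 + b\<^sup>2"
  have "r \<noteq> 0"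
    using nonzero by (auto simp: r_def)
  have along: "along p * r = a * (x - x\<^sub>0) + b * (y - y\<^sub>0)"
    using \<open>r \<noteq> 0\<close> by (simp add: along_def p r_def)
  have "a * (along p * r) - across p * b = (x - x\<^sub>0) * r" "b * (along p * r) + across p * a = (y - y\<^sub>0) * r"
    unfolding along by (simp_all add: across_def p r_def algebra_simps power2_eq_square)
  then have "x\<^sub>0 + along p * a - across p * b / r = x" "y\<^sub>0 + along p * b + across p * a / r = y"
    using \<open>r \<noteq> 0\<close> by (simp_all add: field_simps)
  then show ?thesis
    by (simp add: point_def Let_def vertical_def r_def) (simp add: p)
qed

lemma point_segment: "point (s, 0, 0) = segment_point s"
  by (simp add: point_def Let_def horizontal_field_def field_simps)

lemma continuous_on_point: "continuous_on S point"
  unfolding point_def Let_def case_prod_beta by (intro continuous_intros) (use nonzero in auto)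

lemma penalty_nonneg: "0 \<le> penalty p"
  by (simp add: penalty_def)

lemma penalty_eq_0_iff: "penalty p = 0 \<longleftrightarrow> (\<exists>s\<in>{0..1}. p = segment_point s)"
proof
  assume "penalty p = 0"
  then have "(across p)\<^sup>2 = 0" "(vertical p)\<^sup>2 = 0" "(max 0 (0 - along p))\<^sup>2 = 0"
    "(max 0 (along p - 1))\<^sup>2 = 0"
    unfolding penalty_def
    using zero_le_power2[of "across p"] zero_le_power2[of "vertical p"]
      zero_le_power2[of "max 0 (0 - along p)"] zero_le_power2[of "max 0 (along p - 1)"] by linarith+
  then have "across p = 0" "vertical p = 0" "along p \<in> {0..1}"
    by auto
  then show "\<exists>s\<in>{0..1}. p = segment_point s"
    using point_coordinates[of p] point_segment by metis
next
  assume "\<exists>s\<in>{0..1}. p = segment_point s"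
  then obtain s where s: "0 \<le> s" "s \<le> 1" "p = segment_point s"
    by auto
  have "across p = 0" "vertical p = 0"
    unfolding s(3) across_field vertical_field by (simp_all add: across_def vertical_def)
  then show "penalty p = 0"
    using s by (simp add: penalty_def along_segment_point)
qed

section \<open>Regularity and sublevel sets of the penalty\<close>

lemma C1_on_along: "C1_on S along"
  unfolding along_def[abs_def] by (intro C1_on_intros)

lemma C1_on_penalty: "C1_on S penalty"
  unfolding penalty_def[abs_def] vertical_def across_def by (intro C1_on_intros C1_on_along)

text \<open>The bound confines \<open>along\<close> to [-1, 2] and the other two coordinates to
  [-1, 1], so the closed sublevel set lies in the continuous image of a box.\<close>

lemma compact_penalty_le:
  assumes "c \<le> 1" shows "compact {p. penalty p \<le> c}"
proof -
  have "compact (point ` ({-1..2} \<times> {-1..1} \<times> {-1..1}))"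
    by (intro compact_continuous_image continuous_on_point compact_Times compact_Icc)
  moreover have "closed {p. penalty p \<le> c}"
    by (intro closed_Collect_le continuous_on_const C1_on_continuous_on C1_on_penalty)
  moreover have "{p. penalty p \<le> c} \<subseteq> point ` ({-1..2} \<times> {-1..1} \<times> {-1..1})"
  proof
    fix p assume "p \<in> {p. penalty p \<le> c}"
    then have "(across p)\<^sup>2 \<le> 1" "(vertical p)\<^sup>2 \<le> 1" "(max 0 (0 - along p))\<^sup>2 \<le> 1"
      "(max 0 (along p - 1))\<^sup>2 \<le> 1"
      using assms zero_le_power2[of "across p"] zero_le_power2[of "vertical p"]
        zero_le_power2[of "max 0 (0 - along p)"] zero_le_power2[of "max 0 (along p - 1)"]
      unfolding penalty_def mem_Collect_eq by linarith+
    then have "\<bar>across p\<bar> \<le> 1" "\<bar>vertical p\<bar> \<le> 1" "max 0 (0 - along p) \<le> 1" "max 0 (along p - 1) \<le> 1"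
      unfolding abs_square_le_1 by auto
    then have "(along p, across p, vertical p) \<in> {-1..2} \<times> {-1..1} \<times> {-1..1}"
      by auto
    then show "p \<in> point ` ({-1..2} \<times> {-1..1} \<times> {-1..1})"
      by (metis point_coordinates imageI)
  qed
  ultimately show ?thesis
    using compact_Int_closed by (metis inf.absorb_iff2)
qed

lemma frechet_derivative_along: "frechet_derivative along (at p) (field p) = 1"
proof (rule frechet_derivative_affine_line)
  show "along differentiable (at p)"
    using C1_on_along[of UNIV] unfolding C1_on_def by blast
  show "along (p + t *\<^sub>R field p) = along p + t * 1" for t
    by (simp add: along_field)
qed (rule zero_less_one)

text \<open>Strictly between the ends, a short move along the field keeps \<open>along\<close> in
  (0, 1), where both end terms vanish and the remaining terms are invariant.\<close>

lemma frechet_derivative_penalty: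
  assumes "0 < along p" "along p < 1"
  shows "frechet_derivative penalty (at p) (field p) = 0"
proof (rule frechet_derivative_affine_line)
  show "penalty differentiable (at p)"
    using C1_on_penalty[of UNIV] unfolding C1_on_def by blast
  show "0 < min (along p) (1 - along p)"
    using assms by simp
  show "penalty (p + t *\<^sub>R field p) = penalty p + t * 0" if "\<bar>t\<bar> < min (along p) (1 - along p)" for t
  proof -
    have "max 0 (0 - (along p + t)) = 0" "max 0 (along p + t - 1) = 0"
      "max 0 (0 - along p) = 0" "max 0 (along p - 1) = 0"
      using that assms by auto
    then show ?thesis
      unfolding penalty_def along_field across_field vertical_field by simp
  qed
qed

text \<open>The penalty vanishes only on the segment, so it attains a positive minimum on the
  compact part of \<open>{p. penalty p \<le> 1}\<close> outside \<open>W\<close>, unless that part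
  is empty.\<close>

lemma penalty_bounded_below_off_neighbourhood:
  assumes W: "open W" "\<And>s. s \<in> {0..1} \<Longrightarrow> segment_point s \<in> W"
  shows "\<exists>\<delta>>0. \<delta> \<le> 1 \<and> {p. penalty p < \<delta>} \<subseteq> W"
proof (cases "{p. penalty p \<le> 1} - W = {}")
  case True
  then show ?thesis
    by (intro exI[of _ 1]) (force simp del: split_paired_All)
next
  case False
  have "compact ({p. penalty p \<le> 1} - W)"
    using compact_penalty_le[of 1] W(1) by (simp add: compact_diff)
  then obtain q where q: "q \<in> {p. penalty p \<le> 1} - W"
    "\<forall>p\<in>{p. penalty p \<le> 1} - W. penalty q \<le> penalty p"
    using continuous_attains_inf[OF _ False C1_on_continuous_on[OF C1_on_penalty]] by blast
  have "penalty q \<noteq> 0"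
  proof
    assume "penalty q = 0"
    then obtain s where "s \<in> {0..1}" "q = segment_point s"
      unfolding penalty_eq_0_iff by blast
    then show False
      using W(2)[of s] q(1) by simp
  qed
  then have "0 < penalty q"
    using penalty_nonneg[of q] by simp
  moreover have "penalty q \<le> 1"
    using q(1) by simp
  moreover have "p \<in> W" if "penalty p < penalty q" for p
  proof (rule ccontr)
    assume "p \<notin> W"
    then have "p \<in> {p. penalty p \<le> 1} - W"
      using that \<open>penalty q \<le> 1\<close> by simp
    then show False
      using bspec[OF q(2)] that by fastforce
  qed
  ultimately show ?thesis
    by blast
qed

text \<open>Adding a large multiple of \<open>penalty * G\<close>, with \<open>G\<close> a differentiable majorant, pushes the
  maximum onto the segment without requiring the function to be bounded above on its domain.\<close>

lemma exists_test_function: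
  assumes \<Omega>: "open \<Omega>" and f: "usc_on \<Omega> f"
    and seg: "\<And>s. s \<in> {0..1} \<Longrightarrow> segment_point s \<in> \<Omega>"
    and ends: "f (segment_point 0) \<le> c" "f (segment_point 1) \<le> c"
    and s0: "s\<^sub>0 \<in> {0..1}" "c < f (segment_point s\<^sub>0)"
    and V: "open V" "segment_point 1 \<in> V"
  shows "\<exists>\<phi> p \<tau>. C1_on \<Omega> \<phi> \<and> p \<in> \<Omega> \<and> (\<forall>x\<in>\<Omega>. f x - \<phi> x \<le> f p - \<phi> p) \<and> c < f p \<and>
    0 < \<tau> \<and> p + \<tau> *\<^sub>R field p \<in> V \<and> 0 < frechet_derivative \<phi> (at p) (field p)"
proof -
  \<comment> \<open>The tilt is small enough to keep the value at \<open>s\<^sub>0\<close> above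
    \<open>c\<close>; the bound 1 lets \<open>\<bar>along x\<bar>\<close> dominate it later.\<close>
  define \<alpha> where "\<alpha> = min 1 ((f (segment_point s\<^sub>0) - c) / 2)"
  have \<alpha>: "0 < \<alpha>" "\<alpha> \<le> 1" "c < f (segment_point s\<^sub>0) - \<alpha>"
    using s0(2) by (auto simp: \<alpha>_def min_def field_simps)
  define g where "g x = f x + - \<alpha> * along x" for x
  have cont_along: "continuous_on S along" for S
    by (rule C1_on_continuous_on[OF C1_on_along])
  have g: "usc_on \<Omega> g"
    unfolding g_def[abs_def]
    by (intro usc_on_add_continuous f \<Omega> continuous_intros cont_along)
  \<comment> \<open>Majorising \<open>f + \<bar>along\<bar>\<close> instead of \<open>f\<close> lets
    \<open>G\<close> absorb the tilt away from the segment as well.\<close>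
  have "usc_on \<Omega> (\<lambda>x. f x + \<bar>along x\<bar>)"
    by (intro usc_on_add_continuous f \<Omega> continuous_intros cont_along)
  from C1_majorant[OF this \<Omega>] obtain G where G: "C1_on \<Omega> G"
    and G_ge: "\<And>x. x \<in> \<Omega> \<Longrightarrow> f x + \<bar>along x\<bar> \<le> G x" "\<And>x. x \<in> \<Omega> \<Longrightarrow> 1 \<le> G x"
    by blast
  define DG where "DG x = frechet_derivative G (at x) (field x)" for x
  have cont_DG: "continuous_on \<Omega> DG"
  proof -
    have "continuous_on \<Omega> (\<lambda>p. a * frechet_derivative G (at p) (1, 0, 0)
      + b * frechet_derivative G (at p) (0, 1, 0)
      + (fst p * b - fst (snd p) * a) / 2 * frechet_derivative G (at p) (0, 0, 1))"
      by (intro continuous_intros C1_on_continuous_derivative[OF G]) auto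
    moreover have "DG p = a * frechet_derivative G (at p) (1, 0, 0)
      + b * frechet_derivative G (at p) (0, 1, 0)
      + (fst p * b - fst (snd p) * a) / 2 * frechet_derivative G (at p) (0, 0, 1)" if "p \<in> \<Omega>" for p
      unfolding DG_def by (rule frechet_derivative_horizontal_field) (use G that in \<open>auto simp: C1_on_def\<close>)
    ultimately show ?thesis
      by (simp cong: continuous_on_cong)
  qed
  define S where "S = segment_point ` {0..1}"
  have S: "compact S" "S \<noteq> {}" "S \<subseteq> \<Omega>"
    unfolding S_def using seg by (auto intro!: compact_continuous_image continuous_intros)
  obtain s\<^sub>1 where s1: "s\<^sub>1 \<in> {0..1}" "\<And>s. s \<in> {0..1} \<Longrightarrow> g (segment_point s) \<le> g (segment_point s\<^sub>1)"
    using usc_on_attains_max[OF g \<Omega> S] unfolding S_def by blast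
  define m where "m = g (segment_point s\<^sub>1)"
  have g_seg: "g (segment_point s) = f (segment_point s) - \<alpha> * s" for s
    unfolding g_def along_segment_point by simp
  have "c < m"
  proof -
    have "\<alpha> * s\<^sub>0 \<le> \<alpha> * 1"
      using \<alpha>(1) s0(1) by (intro mult_left_mono) auto
    then show ?thesis
      using \<alpha>(3) s1(2)[OF s0(1)] g_seg[of s\<^sub>0] by (simp add: m_def)
  qed
  have "bounded (DG ` S)"
    by (intro compact_imp_bounded compact_continuous_image continuous_on_subset[OF cont_DG] S)
  then obtain B where B: "\<And>x. x \<in> S \<Longrightarrow> \<bar>DG x\<bar> \<le> B"
    unfolding bounded_iff by auto
  \<comment> \<open>The added 1 makes \<open>L\<close> positive and the bound on the segment
    strict.\<close>
  define L where "L = max B 0 + 1"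
  have L: "0 < L" "\<And>x. x \<in> S \<Longrightarrow> \<bar>DG x\<bar> < L"
    using B by (force simp: L_def)+
  \<comment> \<open>The first set collects points below the level \<open>m\<close>, among them both
    end points of the segment. The second encodes what the maximum point must satisfy, and it
    contains all other segment points.\<close>
  define W where "W = {x \<in> \<Omega>. g x < m} \<union> ({x \<in> \<Omega>. g x < m + \<alpha> / L} \<inter> {x \<in> \<Omega>. \<bar>DG x\<bar> < L} \<inter>
    {x. 0 < along x} \<inter> {x. along x < 1} \<inter> (\<Union>\<tau>\<in>{0<..}. (\<lambda>x. x + \<tau> *\<^sub>R field x) -` V))"
  have "open {x \<in> \<Omega>. \<bar>DG x\<bar> < L}"
  proof -
    have "open (\<Omega> \<inter> DG -` {- L<..<L})"
      using cont_DG \<Omega> by (rule continuous_open_preimage) simp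
    moreover have "\<Omega> \<inter> DG -` {- L<..<L} = {x \<in> \<Omega>. \<bar>DG x\<bar> < L}"
      by auto
    ultimately show ?thesis by simp
  qed
  moreover have "open ((\<lambda>x. x + \<tau> *\<^sub>R field x) -` V)" for \<tau>
    unfolding horizontal_field_def by (intro open_vimage V continuous_intros) auto
  ultimately have "open W"
    unfolding W_def
    by (intro open_Un open_Int open_UN ballI usc_on_open_sublevel[OF g \<Omega>] open_Collect_less
        cont_along continuous_on_const)
  moreover have "segment_point s \<in> W" if s: "s \<in> {0..1}" for s
  proof (cases "s = 0 \<or> s = 1")
    case True
    then have "g (segment_point s) < m"
      using ends \<open>c < m\<close> \<alpha>(1) g_seg[of s] by auto
    then show ?thesis
      using seg[OF s] unfolding W_def by blast
  next
    case False
    have "g (segment_point s) \<le> m"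
      using s1(2)[OF s] by (simp add: m_def)
    then have "g (segment_point s) < m + \<alpha> / L"
      using divide_pos_pos[OF \<alpha>(1) L(1)] by linarith
    \<comment> \<open>Moving on by the remaining parameter \<open>1 - s\<close> reaches the far end
      point.\<close>
    moreover have "segment_point s + (1 - s) *\<^sub>R field (segment_point s) = segment_point 1"
      unfolding horizontal_field_along by (simp add: algebra_simps)
    then have "\<exists>\<tau>\<in>{0<..}. segment_point s + \<tau> *\<^sub>R field (segment_point s) \<in> V"
      by (intro bexI[of _ "1 - s"]) (use V(2) s False in \<open>simp_all only:, simp\<close>)
    moreover have "\<bar>DG (segment_point s)\<bar> < L"
      by (rule L(2)[unfolded S_def, OF imageI[OF s]])
    moreover have "0 < along (segment_point s)" "along (segment_point s) < 1"
      unfolding along_segment_point using s False by auto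
    ultimately show ?thesis
      unfolding W_def using seg[OF s] by blast
  qed
  ultimately obtain \<delta> where \<delta>: "0 < \<delta>" "\<delta> \<le> 1" "{p. penalty p < \<delta>} \<subseteq> W"
    using penalty_bounded_below_off_neighbourhood by blast
  define K where "K = {p. penalty p \<le> \<delta> / 2}"
  have K: "compact K" "K \<subseteq> W" "segment_point s\<^sub>1 \<in> K"
  proof -
    show "compact K"
      unfolding K_def by (rule compact_penalty_le) (use \<delta> in simp)
    show "K \<subseteq> W"
      using \<delta> by (force simp: K_def simp del: split_paired_All)
    have "penalty (segment_point s\<^sub>1) = 0"
      using s1(1) penalty_eq_0_iff by blast
    then show "segment_point s\<^sub>1 \<in> K"
      using \<delta>(1) by (simp add: K_def)
  qed
  have "W \<subseteq> \<Omega>"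
    unfolding W_def by blast
  then have "K \<subseteq> \<Omega>"
    using K(2) by blast
  \<comment> \<open>Off \<open>K\<close> the penalty exceeds \<open>\<delta> / 2\<close>, so this
    value gives \<open>1 + \<bar>m\<bar> \<le> N * penalty x\<close> there.\<close>
  define N where "N = 2 * (1 + \<bar>m\<bar>) / \<delta>"
  have N: "0 < N"
    using \<delta>(1) by (simp add: N_def add_pos_nonneg)
  define \<phi> where "\<phi> x = \<alpha> * along x + N * (penalty x * G x)" for x
  have C1: "C1_on \<Omega> \<phi>"
    unfolding \<phi>_def[abs_def] by (intro C1_on_intros C1_on_along C1_on_penalty G)
  have f\<phi>: "f x - \<phi> x = g x - N * (penalty x * G x)" for x
    by (simp add: \<phi>_def g_def)
  have "usc_on \<Omega> (\<lambda>x. f x + - \<phi> x)"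
    by (intro usc_on_add_continuous f \<Omega> continuous_on_minus C1_on_continuous_on[OF C1])
  moreover have "K \<noteq> {}"
    using K(3) by blast
  ultimately obtain p where p: "p \<in> K" "\<And>x. x \<in> K \<Longrightarrow> f x - \<phi> x \<le> f p - \<phi> p"
    using usc_on_attains_max[OF _ \<Omega> K(1) _ \<open>K \<subseteq> \<Omega>\<close>, of "\<lambda>x. f x + - \<phi> x"]
    unfolding add_uminus_conv_diff by blast
  have "p \<in> W" "p \<in> \<Omega>"
    using p(1) K(2) \<open>K \<subseteq> \<Omega>\<close> by auto
  have m_le: "m \<le> f p - \<phi> p"
  proof -
    have "penalty (segment_point s\<^sub>1) = 0"
      using s1(1) penalty_eq_0_iff by blast
    then show ?thesis
      using p(2)[OF K(3)] unfolding f\<phi>[of "segment_point s\<^sub>1"] by (simp add: m_def)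
  qed
  \<comment> \<open>Off \<open>K\<close>, the bounds on \<open>G\<close> give \<open>f x - \<phi> x
    \<le> G x - (1 + \<bar>m\<bar>) * G x \<le> - \<bar>m\<bar> \<le> m\<close>.\<close>
  have max: "f x - \<phi> x \<le> f p - \<phi> p" if x: "x \<in> \<Omega>" for x
  proof (cases "x \<in> K")
    case True
    then show ?thesis by (rule p(2))
  next
    case False
    then have "1 + \<bar>m\<bar> \<le> N * penalty x"
      using \<delta>(1) mult_left_mono[of "\<delta> / 2" "penalty x" N] N by (simp add: K_def N_def)
    then have "(1 + \<bar>m\<bar>) * G x \<le> N * penalty x * G x"
      using G_ge(2)[OF x] by (intro mult_right_mono) auto
    moreover have "\<bar>m\<bar> * 1 \<le> \<bar>m\<bar> * G x"
      using G_ge(2)[OF x] by (intro mult_left_mono) auto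
    moreover have "- \<alpha> * along x \<le> \<bar>along x\<bar>"
    proof -
      have "\<bar>- \<alpha> * along x\<bar> \<le> \<bar>along x\<bar>"
        using \<alpha> by (simp add: abs_mult mult_left_le_one_le)
      then show ?thesis by linarith
    qed
    ultimately have "f x - \<phi> x \<le> - \<bar>m\<bar>"
      using G_ge(1)[OF x] unfolding \<phi>_def by (simp add: algebra_simps)
    then show ?thesis
      using m_le by linarith
  qed
  have pen: "0 \<le> N * penalty p" "N * penalty p \<le> N * (penalty p * G p)"
    using N penalty_nonneg[of p] G_ge(2)[OF \<open>p \<in> \<Omega>\<close>] by (auto simp: mult_le_cancel_left1)
  \<comment> \<open>The penalty term only lowers the value, so \<open>g p\<close> is at least
    \<open>m\<close>; this excludes the first part of \<open>W\<close>.\<close>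
  have "m \<le> g p"
    using m_le pen unfolding f\<phi> by linarith
  with \<open>p \<in> W\<close> obtain \<tau> where W: "g p < m + \<alpha> / L" "\<bar>DG p\<bar> < L" "0 < along p" "along p < 1"
    "0 < \<tau>" "p + \<tau> *\<^sub>R field p \<in> V"
    unfolding W_def by force
  have "c < f p"
    using \<open>c < m\<close> \<open>m \<le> g p\<close> mult_pos_pos[OF \<alpha>(1) W(3)] unfolding g_def by simp
  moreover have "0 < frechet_derivative \<phi> (at p) (field p)"
  proof -
    note D = C1_on_has_derivative[OF _ UNIV_I]
    have "(\<phi> has_derivative (\<lambda>v. \<alpha> * frechet_derivative along (at p) v
      + N * (penalty p * frechet_derivative G (at p) v + frechet_derivative penalty (at p) v * G p))) (at p)"
      unfolding \<phi>_def[abs_def]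
      by (intro has_derivative_add has_derivative_mult has_derivative_mult_right
          D C1_on_along C1_on_penalty C1_on_has_derivative[OF G \<open>p \<in> \<Omega>\<close>])
    \<comment> \<open>The penalty is stationary along the field at \<open>p\<close>, so only the
      tilt and the derivative of \<open>G\<close> contribute.\<close>
    then have "frechet_derivative \<phi> (at p) (field p) = \<alpha> + N * penalty p * DG p"
      by (simp add: frechet_derivative_at[symmetric] frechet_derivative_along
          frechet_derivative_penalty W DG_def mult.assoc)
    moreover have "N * penalty p * \<bar>DG p\<bar> < \<alpha>"
    proof -
      \<comment> \<open>Since \<open>G p \<ge> 1\<close>, the term \<open>N * penalty p\<close> is
        at most the gap \<open>g p - m\<close>, which \<open>W\<close> keeps below
        \<open>\<alpha> / L\<close>.\<close>
      have "N * penalty p < \<alpha> / L"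
        using m_le pen W(1) unfolding f\<phi> by linarith
      then have "N * penalty p * L < \<alpha>"
        using L(1) by (simp add: field_simps)
      moreover have "N * penalty p * \<bar>DG p\<bar> \<le> N * penalty p * L"
        using pen(1) W(2) by (intro mult_left_mono) auto
      ultimately show ?thesis by linarith
    qed
    moreover have "N * penalty p * - \<bar>DG p\<bar> \<le> N * penalty p * DG p"
      using pen(1) by (intro mult_left_mono) auto
    ultimately show ?thesis
      by simp
  qed
  ultimately show ?thesis
    using C1 \<open>p \<in> \<Omega>\<close> max W(5,6) by blast
qed

end

subsection \<open>The characterisation of h-quasiconvexity\<close>

lemma h_quasiconvex_imp_gradient_nonpos:
  fixes u :: "heis \<Rightarrow> ereal"
  assumes \<Omega>: "open \<Omega>" and fin: "\<forall>p\<in>\<Omega>. u p < \<infinity>" and u: "h_quasiconvex_on \<Omega> u"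
    and p: "p \<in> \<Omega>" and \<phi>: "C1_on \<Omega> \<phi>"
    and max: "\<forall>x\<in>\<Omega>. u x - ereal (\<phi> x) \<le> u p - ereal (\<phi> p)"
    and \<xi>: "\<xi> \<in> horizontal_plane p \<inter> \<Omega>" "u \<xi> < u p"
  shows "horizontal_gradient \<phi> p \<bullet> horizontal_part (heis_inv p \<odot> \<xi>) \<le> 0"
proof -
  obtain a b where ab: "\<xi> = p + horizontal_field a b p"
    using \<xi>(1) horizontal_plane_iff by blast
  define v where "v = horizontal_field a b p"
  have diff: "\<phi> differentiable (at p)"
    using \<phi> p unfolding C1_on_def by blast
  obtain e where e: "0 < e" "\<And>t. \<bar>t\<bar> < e \<Longrightarrow> p + t *\<^sub>R v \<in> \<Omega>"
  proof -
    have "open ((\<lambda>t. p + t *\<^sub>R v) -` \<Omega>)"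
      by (intro open_vimage \<Omega> continuous_intros)
    moreover have "0 \<in> (\<lambda>t. p + t *\<^sub>R v) -` \<Omega>"
      using p by simp
    ultimately obtain e where "0 < e" "ball 0 e \<subseteq> (\<lambda>t. p + t *\<^sub>R v) -` \<Omega>"
      by (rule openE)
    then show thesis
      using that[of e] by (simp add: subset_iff del: split_paired_All)
  qed
  \<comment> \<open>The point \<open>p\<close> lies between \<open>\<xi>\<close> and the points just
    behind \<open>p\<close>, so quasiconvexity and \<open>u \<xi> < u p\<close> force
    \<open>u\<close> to be at least \<open>u p\<close> at the latter; maximality passes this on to
    \<open>\<phi>\<close>.\<close>
  have *: "\<phi> p \<le> \<phi> (p + (- t) *\<^sub>R v)" if t: "0 < t" "t < e" for t
  proof -
    define w where "w = p + (- t) *\<^sub>R v"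
    have w: "w \<in> \<Omega>"
      using e(2)[of "- t"] t by (simp add: w_def)
    have field: "horizontal_field a b w = v"
      unfolding w_def v_def by (rule horizontal_field_along)
    have "\<xi> = w + (1 + t) *\<^sub>R v"
      unfolding w_def ab v_def by (simp add: algebra_simps)
    then have \<xi>w: "\<xi> = w + horizontal_field ((1 + t) * a) ((1 + t) * b) w"
      unfolding horizontal_field_scale field .
    \<comment> \<open>The weight solves \<open>p = (1 - s) *\<^sub>R w + s *\<^sub>R \<xi>\<close>,
      where \<open>w = p - t *\<^sub>R v\<close> and \<open>\<xi> = p + v\<close>.\<close>
    define s where "s = t / (1 + t)"
    have s: "0 \<le> s" "s \<le> 1" "s * (1 + t) = t"
      using t by (simp_all add: s_def)
    have "(1 - s) *\<^sub>R w + s *\<^sub>R \<xi> = w + (s * (1 + t)) *\<^sub>R v"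
      unfolding \<open>\<xi> = w + (1 + t) *\<^sub>R v\<close> by (simp add: algebra_simps)
    then have "p = (1 - s) *\<^sub>R w + s *\<^sub>R \<xi>"
      unfolding s(3) by (simp add: w_def)
    then have "p \<in> closed_segment w \<xi>"
      unfolding closed_segment_def using s by blast
    then have "u p \<le> max (u w) (u \<xi>)"
      using u w \<xi>(1) \<xi>w horizontal_plane_iff unfolding h_quasiconvex_on_def by blast
    then have "u p \<le> u w"
      using \<xi>(2) by (auto simp: max_def split: if_splits)
    moreover have "u w - ereal (\<phi> w) \<le> u p - ereal (\<phi> p)"
      using max w by blast
    \<comment> \<open>Finiteness of both values permits cancellation in the extended reals;
      \<open>u p\<close> exceeds \<open>u \<xi>\<close> and hence
      \<open>- \<infinity>\<close>.\<close>
    moreover have "u p < \<infinity>" "u w < \<infinity>" "- \<infinity> < u p"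
      using fin p w \<xi>(2) by (auto simp: less_le_trans order_le_less_trans)
    ultimately show ?thesis
      unfolding w_def[symmetric] by (cases "u p"; cases "u w") auto
  qed
  have "frechet_derivative \<phi> (at p) v \<le> 0"
  proof (rule ccontr)
    assume "\<not> ?thesis"
    then obtain d where d: "0 < d" "\<And>h. 0 < h \<Longrightarrow> h < d \<Longrightarrow> \<phi> (p + (0 - h) *\<^sub>R v) < \<phi> (p + 0 *\<^sub>R v)"
      using DERIV_pos_inc_left[OF DERIV_along_line[OF diff, of v]] by auto
    obtain h where "0 < h" "h < d" "h < e"
      using field_lbound_gt_zero[OF d(1) e(1)] by blast
    then show False
      using *[of h] d(2)[of h] by simp
  qed
  then show ?thesis
    unfolding ab horizontal_part_displacement horizontal_gradient_inner[OF diff] v_def .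
qed

text \<open>The strict bound at \<open>x\<close> itself extends the punctured neighbourhood filter
  to the full one.\<close>

lemma upper_semicontinuous_on_nhds:
  assumes "upper_semicontinuous_on \<Omega> u" "open \<Omega>" "x \<in> \<Omega>" "u x < c"
  shows "\<forall>\<^sub>F y in nhds x. u y < c"
proof -
  have "\<forall>\<^sub>F y in at x. u y < c"
    using assms at_within_open[OF assms(3,2)] unfolding upper_semicontinuous_on_def by metis
  then show ?thesis
    using assms(4) by (auto simp: eventually_nhds_conv_at)
qed

text \<open>A violation on a segment is fed to \<open>exists_test_function\<close>; the horizontal
  translate near the end point \<open>q\<close> has a value below \<open>c\<close>, and the positive
  derivative in its direction contradicts the hypothesis.\<close>

lemma gradient_nonpos_imp_h_quasiconvex:
  fixes u :: "heis \<Rightarrow> ereal"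
  assumes \<Omega>: "open \<Omega>" "h_convex \<Omega>" and fin: "\<forall>p\<in>\<Omega>. u p < \<infinity>"
    and usc: "upper_semicontinuous_on \<Omega> u"
    and test: "\<And>p \<phi> \<xi>. p \<in> \<Omega> \<Longrightarrow> C1_on \<Omega> \<phi> \<Longrightarrow>
      \<forall>x\<in>\<Omega>. u x - ereal (\<phi> x) \<le> u p - ereal (\<phi> p) \<Longrightarrow> \<xi> \<in> horizontal_plane p \<inter> \<Omega> \<Longrightarrow> u \<xi> < u p \<Longrightarrow>
      horizontal_gradient \<phi> p \<bullet> horizontal_part (heis_inv p \<odot> \<xi>) \<le> 0"
  shows "h_quasiconvex_on \<Omega> u"
  unfolding h_quasiconvex_on_def
proof (intro ballI, rule ccontr)
  fix p q w
  assume p: "p \<in> \<Omega>" and q: "q \<in> horizontal_plane p \<inter> \<Omega>" and w: "w \<in> closed_segment p q"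
    and "\<not> u w \<le> max (u p) (u q)"
  then have "max (u p) (u q) < u w"
    by (simp only: not_le)
  \<comment> \<open>A real level between the two values exists even if both end values are
    \<open>- \<infinity>\<close>.\<close>
  then obtain c where c: "max (u p) (u q) < ereal c" "ereal c < u w"
    by (rule ereal_dense2[THEN exE]) blast
  obtain a b where qab: "q = p + horizontal_field a b p"
    using IntD1[OF q] unfolding horizontal_plane_iff by blast
  obtain s where s: "s \<in> {0..1}" "w = (1 - s) *\<^sub>R p + s *\<^sub>R q"
    using w unfolding closed_segment_def by auto
  then have ws: "w = p + s *\<^sub>R horizontal_field a b p"
    unfolding qab by (simp add: algebra_simps)
  obtain x\<^sub>0 y\<^sub>0 z\<^sub>0 where p0: "p = (x\<^sub>0, y\<^sub>0, z\<^sub>0)"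
    by (cases p)
  \<comment> \<open>A degenerate direction would give \<open>w = p\<close>, against the strict
    inequality at \<open>w\<close>.\<close>
  have "0 < a\<^sup>2 + b\<^sup>2"
  proof (rule ccontr)
    assume "\<not> ?thesis"
    then have "a = 0" "b = 0"
      by (simp_all add: not_less sum_power2_le_zero_iff)
    then have "w = p"
      using ws by (simp add: horizontal_field_def flip: zero_prod_def)
    then show False
      using c less_asym by auto
  qed
  then interpret horizontal_line x\<^sub>0 y\<^sub>0 z\<^sub>0 a b
    by unfold_locales
  \<comment> \<open>Truncation from below at \<open>c\<close> makes the function real-valued on
    \<open>\<Omega>\<close> and leaves it unchanged where it exceeds \<open>c\<close>.\<close>
  define f where "f x = real_of_ereal (max (u x) (ereal c))" for x
  have f: "ereal (f x) = max (u x) (ereal c)" if "x \<in> \<Omega>" for x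
    using bspec[OF fin that] by (cases "u x") (auto simp: f_def max_def)
  have f_usc: "usc_on \<Omega> f"
    unfolding usc_on_def
  proof (intro ballI allI impI)
    fix x d assume x: "x \<in> \<Omega>" and d: "f x < d"
    then have "max (u x) (ereal c) < ereal d"
      unfolding f[OF x, symmetric] by simp
    then have "u x < ereal d" and "c < d"
      by simp_all
    then have "\<forall>\<^sub>F y in nhds x. u y < ereal d \<and> y \<in> \<Omega>"
      using upper_semicontinuous_on_nhds[OF usc \<Omega>(1) x] eventually_nhds_in_open[OF \<Omega>(1) x]
      by (simp add: eventually_conj_iff)
    then show "\<forall>\<^sub>F y in nhds x. f y < d"
    proof eventually_elim
      case (elim y)
      then have "ereal (f y) < ereal d"
        using f[of y] \<open>c < d\<close> by simp
      then show ?case by simp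
    qed
  qed
  define V where "V = {x \<in> \<Omega>. u x < ereal c}"
  have "open V"
  proof (subst open_subopen, rule ballI)
    fix x assume "x \<in> V"
    then have "\<forall>\<^sub>F y in nhds x. u y < ereal c \<and> y \<in> \<Omega>"
      using upper_semicontinuous_on_nhds[OF usc \<Omega>(1), of x] eventually_nhds_in_open[OF \<Omega>(1), of x]
      by (simp add: eventually_conj_iff V_def)
    then show "\<exists>T. open T \<and> x \<in> T \<and> T \<subseteq> V"
      unfolding eventually_nhds V_def by blast
  qed
  have seg: "segment_point t \<in> \<Omega>" if t: "t \<in> {0..1}" for t
  proof -
    have "segment_point t = (1 - t) *\<^sub>R p + t *\<^sub>R q"
      unfolding qab p0[symmetric] by (simp add: algebra_simps)
    then have "segment_point t \<in> closed_segment p q"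
      using t unfolding closed_segment_def by auto
    then show ?thesis
      using \<Omega>(2) p q unfolding h_convex_def by blast
  qed
  have pts: "segment_point 0 = p" "segment_point 1 = q" "segment_point s = w"
    using ws qab p0 by simp_all
  have "w \<in> \<Omega>"
    using seg[OF s(1)] pts by simp
  have "ereal (f p) \<le> ereal c" "ereal (f q) \<le> ereal c" "ereal c < ereal (f w)"
    unfolding f[OF p] f[OF IntD2[OF q]] f[OF \<open>w \<in> \<Omega>\<close>] using c by (auto simp: less_max_iff_disj)
  then have "f p \<le> c" "f q \<le> c" "c < f w"
    by simp_all
  moreover have "q \<in> V"
    using c(1) q by (simp add: V_def)
  ultimately obtain \<phi> \<zeta> \<tau> where \<phi>: "C1_on \<Omega> \<phi>" and \<zeta>: "\<zeta> \<in> \<Omega>"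
    and max: "\<forall>x\<in>\<Omega>. f x - \<phi> x \<le> f \<zeta> - \<phi> \<zeta>" and "c < f \<zeta>" "0 < \<tau>"
    and V: "\<zeta> + \<tau> *\<^sub>R horizontal_field a b \<zeta> \<in> V"
    and pos: "0 < frechet_derivative \<phi> (at \<zeta>) (horizontal_field a b \<zeta>)"
    using exists_test_function[OF \<Omega>(1) f_usc seg _ _ s(1) _ \<open>open V\<close>, of c]
    unfolding pts by blast
  \<comment> \<open>The truncation is inactive at \<open>\<zeta>\<close> because
    \<open>c < f \<zeta>\<close>; elsewhere it can only raise values, so \<open>\<zeta>\<close> also
    maximises \<open>u - \<phi>\<close>.\<close>
  have u\<zeta>: "u \<zeta> = ereal (f \<zeta>)"
    using f[OF \<zeta>] \<open>c < f \<zeta>\<close> by (auto simp: max_def split: if_splits)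
  have \<zeta>_max: "\<forall>x\<in>\<Omega>. u x - ereal (\<phi> x) \<le> u \<zeta> - ereal (\<phi> \<zeta>)"
  proof
    fix x assume x: "x \<in> \<Omega>"
    have "u x \<le> ereal (f x)"
      using f[OF x] by simp
    then have "u x - ereal (\<phi> x) \<le> ereal (f x) - ereal (\<phi> x)"
      by (rule ereal_minus_mono) simp
    also have "\<dots> \<le> u \<zeta> - ereal (\<phi> \<zeta>)"
      using max x by (simp add: u\<zeta>)
    finally show "u x - ereal (\<phi> x) \<le> u \<zeta> - ereal (\<phi> \<zeta>)" .
  qed
  define \<xi> where "\<xi> = \<zeta> + horizontal_field (\<tau> * a) (\<tau> * b) \<zeta>"
  have "\<xi> \<in> V"
    using V unfolding \<xi>_def horizontal_field_scale .
  then have "u \<xi> < u \<zeta>"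
    using \<open>c < f \<zeta>\<close> less_trans[of "u \<xi>" "ereal c" "ereal (f \<zeta>)"] by (simp add: u\<zeta> V_def)
  moreover have "\<xi> \<in> horizontal_plane \<zeta>"
    unfolding horizontal_plane_iff \<xi>_def by blast
  ultimately have "horizontal_gradient \<phi> \<zeta> \<bullet> horizontal_part (heis_inv \<zeta> \<odot> \<xi>) \<le> 0"
    using test[OF \<zeta> \<phi> \<zeta>_max] \<open>\<xi> \<in> V\<close> by (simp add: V_def)
  moreover have diff: "\<phi> differentiable (at \<zeta>)"
    using \<phi> \<zeta> unfolding C1_on_def by blast
  ultimately have "frechet_derivative \<phi> (at \<zeta>) (horizontal_field (\<tau> * a) (\<tau> * b) \<zeta>) \<le> 0"
    unfolding \<xi>_def horizontal_part_displacement horizontal_gradient_inner[OF diff] by simp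
  then have "\<tau> * frechet_derivative \<phi> (at \<zeta>) (horizontal_field a b \<zeta>) \<le> 0"
    unfolding horizontal_field_scale linear_scale[OF linear_frechet_derivative[OF diff]] by simp
  then show False
    using mult_pos_pos[OF \<open>0 < \<tau>\<close> pos] by linarith
qed

theorem theorem2p6:
  fixes \<Omega> :: "heis set" and u :: "heis \<Rightarrow> ereal"
  assumes "open \<Omega>" and "h_convex \<Omega>"
    and "\<forall>p\<in>\<Omega>. u p < \<infinity>"
    and "upper_semicontinuous_on \<Omega> u"
  shows "h_quasiconvex_on \<Omega> u \<longleftrightarrow>
    (\<forall>p\<in>\<Omega>. \<forall>\<phi>. C1_on \<Omega> \<phi> \<longrightarrow>
       (\<forall>x\<in>\<Omega>. u x - ereal (\<phi> x) \<le> u p - ereal (\<phi> p)) \<longrightarrow>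
       (\<forall>\<xi>\<in>horizontal_plane p \<inter> \<Omega>. u \<xi> < u p \<longrightarrow>
          horizontal_gradient \<phi> p \<bullet> horizontal_part (heis_inv p \<odot> \<xi>) \<le> 0))"
proof
  assume "h_quasiconvex_on \<Omega> u"
  then show "\<forall>p\<in>\<Omega>. \<forall>\<phi>. C1_on \<Omega> \<phi> \<longrightarrow>
       (\<forall>x\<in>\<Omega>. u x - ereal (\<phi> x) \<le> u p - ereal (\<phi> p)) \<longrightarrow>
       (\<forall>\<xi>\<in>horizontal_plane p \<inter> \<Omega>. u \<xi> < u p \<longrightarrow>
          horizontal_gradient \<phi> p \<bullet> horizontal_part (heis_inv p \<odot> \<xi>) \<le> 0)"
    using h_quasiconvex_imp_gradient_nonpos[OF assms(1,3)] by blast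
next
  assume *: "\<forall>p\<in>\<Omega>. \<forall>\<phi>. C1_on \<Omega> \<phi> \<longrightarrow>
       (\<forall>x\<in>\<Omega>. u x - ereal (\<phi> x) \<le> u p - ereal (\<phi> p)) \<longrightarrow>
       (\<forall>\<xi>\<in>horizontal_plane p \<inter> \<Omega>. u \<xi> < u p \<longrightarrow>
          horizontal_gradient \<phi> p \<bullet> horizontal_part (heis_inv p \<odot> \<xi>) \<le> 0)"
  show "h_quasiconvex_on \<Omega> u"
    by (rule gradient_nonpos_imp_h_quasiconvex[OF assms]) (use * in blast)
qed

end
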